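(* Let $x,y,u_1,u_2,u_3,u_4,f,g,t,\alpha,\beta$ be commuting variables with $xy=u_1u_2$ and $x+y=u_3+u_4$. Then, as formal power series in $z$, $$\sum_{n\ge 0}A_n(u_1,u_2,u_3,u_4,f,g,t\,|\,\alpha,\beta)\frac{z^n}{n!}=e^{(\alpha u_3+\beta u_4)tz}\left(\frac{x-y}{xe^{yz}-ye^{xz}}\right)^{\alpha f+\beta g}.$$
   Context: $\mathfrak{S}_m$ is the symmetric group on $[m]=\{1,\dots,m\}$; permutations are written as words $\sigma=\sigma_1\cdots\sigma_m$. For $\sigma\in\mathfrak{S}_m$ put $\sigma_0=\sigma_{m+1}=0$. A letter $\sigma_i$ ($1\le i\le m$) is a valley if $\sigma_{i-1}>\sigma_i<\sigma_{i+1}$, a peak if $\sigma_{i-1}<\sigma_i>\sigma_{i+1}$, a double ascent if $\sigma_{i-1}<\sigma_i<\sigma_{i+1}$, a double descent if $\sigma_{i-1}>\sigma_i>\sigma_{i+1}$; their numbers are $\mathrm{val},\mathrm{pk},\mathrm{da},\mathrm{dd}$. A letter $\sigma_i$ is a left-to-right maximum if $\sigma_i>\sigma_j$ for all $1\le j<i$, and a right-to-left maximum if $\sigma_i>\sigma_j$ for all $i<j\le m$; their numbers are $\mathrm{lmax},\mathrm{rmax}$. $\mathrm{lmaxpk}$ (resp. $\mathrm{lmaxda}$) is the number of left-to-right maxima that are peaks (resp. double ascents); $\mathrm{rmaxpk}$ (resp. $\mathrm{rmaxdd}$) is the number of right-to-left maxima that are peaks (resp. double descents). Define $$A_n(u_1,u_2,u_3,u_4,f,g,t\,|\,\alpha,\beta)=\sum_{\sigma\in\mathfrak{S}_{n+1}}(u_1u_2)^{\mathrm{val}(\sigma)}u_3^{\mathrm{da}(\sigma)}u_4^{\mathrm{dd}(\sigma)}f^{\mathrm{lmaxpk}(\sigma)-1}g^{\mathrm{rmaxpk}(\sigma)-1}t^{\mathrm{lmaxda}(\sigma)+\mathrm{rmaxdd}(\sigma)}\alpha^{\mathrm{lmax}(\sigma)-1}\beta^{\mathrm{rmax}(\sigma)-1}.$$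 The quotient $\frac{x-y}{xe^{yz}-ye^{xz}}$ is understood as a formal power series in $z$ with constant term $1$ (after cancelling $x-y$), and for such a series $S$, $S^{c}=\exp(c\log S)$. *)

theory Defs
  imports
    "HOL-Computational_Algebra.Formal_Power_Series"
    "HOL-Combinatorics.Multiset_Permutations"
begin

section \<open>Permutations as words and their statistics\<close>

text \<open>
  A permutation of \<open>{1..m}\<close> is a word \<open>w\<close>, a member of \<^term>\<open>permutations_of_set {1..m}\<close>.
  Lists are indexed from 0, so padding with a zero at both ends makes
  \<open>letter w i\<close> the \<open>i\<close>-th letter for \<open>1 \<le> i \<le> m\<close>, and 0 for \<open>i = 0\<close> and \<open>i = m + 1\<close>.
  The sets below consist of positions; as the letters are distinct, counting positions
  is the same as counting letters.
\<close>

definition letter :: "nat list \<Rightarrow> nat \<Rightarrow> nat" where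
  "letter w i = (0 # w @ [0]) ! i"

definition valleys :: "nat list \<Rightarrow> nat set" where
  "valleys w = {i \<in> {1..length w}. letter w (i - 1) > letter w i \<and> letter w i < letter w (i + 1)}"

definition peaks :: "nat list \<Rightarrow> nat set" where
  "peaks w = {i \<in> {1..length w}. letter w (i - 1) < letter w i \<and> letter w i > letter w (i + 1)}"

definition double_ascents :: "nat list \<Rightarrow> nat set" where
  "double_ascents w =
     {i \<in> {1..length w}. letter w (i - 1) < letter w i \<and> letter w i < letter w (i + 1)}"

definition double_descents :: "nat list \<Rightarrow> nat set" where
  "double_descents w =
     {i \<in> {1..length w}. letter w (i - 1) > letter w i \<and> letter w i > letter w (i + 1)}"

definition lr_maxima :: "nat list \<Rightarrow> nat set" where
  "lr_maxima w = {i \<in> {1..length w}. \<forall>j. 1 \<le> j \<and> j < i \<longrightarrow> letter w i > letter w j}"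

definition rl_maxima :: "nat list \<Rightarrow> nat set" where
  "rl_maxima w = {i \<in> {1..length w}. \<forall>j. i < j \<and> j \<le> length w \<longrightarrow> letter w i > letter w j}"

definition val :: "nat list \<Rightarrow> nat" where "val w = card (valleys w)"
definition da :: "nat list \<Rightarrow> nat" where "da w = card (double_ascents w)"
definition dd :: "nat list \<Rightarrow> nat" where "dd w = card (double_descents w)"
definition lmax :: "nat list \<Rightarrow> nat" where "lmax w = card (lr_maxima w)"
definition rmax :: "nat list \<Rightarrow> nat" where "rmax w = card (rl_maxima w)"
definition lmaxpk :: "nat list \<Rightarrow> nat" where "lmaxpk w = card (lr_maxima w \<inter> peaks w)"
definition lmaxda :: "nat list \<Rightarrow> nat" where "lmaxda w = card (lr_maxima w \<inter> double_ascents w)"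
definition rmaxpk :: "nat list \<Rightarrow> nat" where "rmaxpk w = card (rl_maxima w \<inter> peaks w)"
definition rmaxdd :: "nat list \<Rightarrow> nat" where "rmaxdd w = card (rl_maxima w \<inter> double_descents w)"

text \<open>
  The subtractions in the exponents never truncate: the largest letter of a nonempty
  permutation is a peak, a left-to-right maximum and a right-to-left maximum
  (\<open>largest_letter\<close> and \<open>maxima_statistics_pos\<close> below).
\<close>

definition A_poly ::
  "nat \<Rightarrow> 'a \<Rightarrow> 'a \<Rightarrow> 'a \<Rightarrow> 'a \<Rightarrow> 'a \<Rightarrow> 'a \<Rightarrow> 'a \<Rightarrow> 'a \<Rightarrow> 'a \<Rightarrow> 'a :: comm_semiring_1" where
  "A_poly n u1 u2 u3 u4 f g t \<alpha> \<beta> =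
     (\<Sum>w \<in> permutations_of_set {1..n+1}.
        (u1 * u2) ^ val w * u3 ^ da w * u4 ^ dd w
        * f ^ (lmaxpk w - 1) * g ^ (rmaxpk w - 1) * t ^ (lmaxda w + rmaxdd w)
        * \<alpha> ^ (lmax w - 1) * \<beta> ^ (rmax w - 1))"

lemma largest_letter:
  assumes w: "w \<in> permutations_of_set {1..n+1}"
  shows "\<exists>i. i \<in> peaks w \<and> i \<in> lr_maxima w \<and> i \<in> rl_maxima w"
proof -
  have set_w: "set w = {1..n+1}" and "distinct w"
    using w by (auto simp: permutations_of_set_def)
  from set_w have "n + 1 \<in> set w" by simp
  then obtain k where k: "k < length w" "w ! k = n + 1" by (auto simp: in_set_conv_nth)
  have letter_eq: "letter w j = (if 1 \<le> j \<and> j \<le> length w then w ! (j - 1) else 0)"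
    if "j \<le> length w + 1" for j
    using that by (cases j) (auto simp: letter_def nth_append not_less le_Suc_eq)
  have less: "letter w j < n + 1" if "j \<le> length w + 1" "j \<noteq> k + 1" for j
  proof (cases "1 \<le> j \<and> j \<le> length w")
    case True
    then have "w ! (j - 1) \<in> set w" by (intro nth_mem) auto
    moreover have "w ! (j - 1) \<noteq> w ! k"
      using True that k \<open>distinct w\<close> by (subst nth_eq_iff_index_eq) auto
    ultimately show ?thesis using that set_w k True by (auto simp: letter_eq)
  qed (use that in \<open>auto simp: letter_eq\<close>)
  have "letter w (k + 1) = n + 1" using k by (simp add: letter_eq)
  then have "k + 1 \<in> peaks w \<and> k + 1 \<in> lr_maxima w \<and> k + 1 \<in> rl_maxima w"
    unfolding peaks_def lr_maxima_def rl_maxima_def using k less by auto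
  then show ?thesis by blast
qed

lemma maxima_statistics_pos:
  assumes "w \<in> permutations_of_set {1..n+1}"
  shows "lmaxpk w \<ge> 1" "rmaxpk w \<ge> 1" "lmax w \<ge> 1" "rmax w \<ge> 1"
proof -
  have "finite (lr_maxima w)" "finite (rl_maxima w)"
    by (auto simp: lr_maxima_def rl_maxima_def)
  with largest_letter[OF assms]
  show "lmaxpk w \<ge> 1" "rmaxpk w \<ge> 1" "lmax w \<ge> 1" "rmax w \<ge> 1"
    by (auto simp: lmaxpk_def rmaxpk_def lmax_def rmax_def Suc_le_eq card_gt_0_iff)
qed


section \<open>The power series on the right-hand side\<close>

text \<open>
  \<open>reduced_denominator x y\<close> is the series
  \<open>(x * exp (y z) - y * exp (x z)) / (x - y)\<close> in \<open>z\<close> with \<open>x - y\<close> cancelled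
  coefficientwise: for \<open>n \<ge> 1\<close> the coefficient of \<open>z^n / n!\<close> in the numerator is
  \<open>x y^n - y x^n = - (x - y) x y (\<Sum>k<n-1. x^k y^(n-2-k))\<close>.
  It is therefore meaningful for \<open>x = y\<close>, too, where the literal quotient is 0/0.
\<close>

definition reduced_denominator :: "'a::field_char_0 \<Rightarrow> 'a \<Rightarrow> 'a fps" where
  "reduced_denominator x y =
     Abs_fps (\<lambda>n. if n = 0 then 1 else - (x * y * (\<Sum>k<n-1. x ^ k * y ^ (n - 2 - k))) / fact n)"

lemma reduced_denominator_cancel:
  "fps_const (x - y) * reduced_denominator x y
     = fps_const x * fps_exp y - fps_const y * fps_exp x"
proof (rule fps_ext)
  fix n
  have "(x - y) * - (x * y * (\<Sum>k<n-1. x ^ k * y ^ (n - 2 - k))) = x * y ^ n - y * x ^ n"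
    if "n > 0"
  proof -
    obtain m where m: "n = Suc m" using \<open>n > 0\<close> by (cases n) auto
    have "(x - y) * (\<Sum>k<n-1. x ^ k * y ^ (n - 2 - k)) = x ^ m - y ^ m"
    proof (cases m)
      case (Suc l)
      have "(\<Sum>k<Suc l. x ^ k * y ^ (l - k)) = (\<Sum>k<Suc l. y ^ (l - k) * x ^ k)"
        by (simp add: mult.commute)
      then show ?thesis
        using diff_power_eq_sum[of x l y] Suc m by (simp add: mult.commute del: sum.lessThan_Suc)
    qed (simp add: m)
    then have "- x * y * ((x - y) * (\<Sum>k<n-1. x ^ k * y ^ (n - 2 - k)))
               = - x * y * (x ^ m - y ^ m)" by simp
    then show ?thesis by (simp add: m algebra_simps)
  qed
  then show "fps_nth (fps_const (x - y) * reduced_denominator x y) n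
      = fps_nth (fps_const x * fps_exp y - fps_const y * fps_exp x) n"
    by (auto simp: reduced_denominator_def diff_divide_distrib[symmetric] minus_divide_left simp del: minus_divide_left[symmetric])
qed

definition exp_quotient :: "'a::field_char_0 \<Rightarrow> 'a \<Rightarrow> 'a fps" where
  "exp_quotient x y = inverse (reduced_denominator x y)"

lemma exp_quotient_nth_0: "fps_nth (exp_quotient x y) 0 = 1"
  by (simp add: exp_quotient_def reduced_denominator_def)

lemma exp_quotient_eq:
  assumes "x \<noteq> y"
  shows "exp_quotient x y
           = fps_const (x - y) / (fps_const x * fps_exp y - fps_const y * fps_exp x)"
proof -
  have *: "fps_nth (reduced_denominator x y) 0 \<noteq> 0"
    by (simp add: reduced_denominator_def)
  have "fps_const (x - y) / (fps_const (x - y) * reduced_denominator x y)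
      = fps_const (x - y) * inverse (fps_const (x - y) * reduced_denominator x y)"
    using * assms by (intro fps_divide_unit) simp
  also have "\<dots> = inverse (reduced_denominator x y)"
    using assms by (simp add: fps_inverse_mult fps_const_inverse mult.assoc[symmetric])
  finally show ?thesis by (simp add: exp_quotient_def reduced_denominator_cancel)
qed

text \<open>
  For a series \<open>S\<close> with constant term 1. The library series \<^term>\<open>fps_ln 1\<close> is \<open>log (1 + z)\<close>,
  so \<open>fps_ln 1 oo (S - 1)\<close> is \<open>log S\<close>.
\<close>

definition fps_cpower :: "'a::field_char_0 fps \<Rightarrow> 'a \<Rightarrow> 'a fps" where
  "fps_cpower S c = fps_exp 1 oo (fps_const c * (fps_ln 1 oo (S - 1)))"

end

theory Submission
  imports Defs
begin

text \<open>
  The idea is to cut a word at its largest letter \<open>m\<close>, \<open>w = \<tau> m \<rho>\<close>, and to remember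
  only the letters that bound the two pieces. A word gets a weight relative to two boundary letters
  \<open>a\<close> and \<open>b\<close>, placed in front of it and behind it, and a left-to-right maximum now has
  to exceed \<open>a\<close> as well, a right-to-left maximum has to exceed \<open>b\<close>. Thus a large boundary
  letter suppresses the maxima seen from its side, and a boundary letter 0 gives the
  original statistics. The weight of \<open>w\<close> between \<open>a\<close> and \<open>b\<close> is the weight of
  \<open>\<tau>\<close> between \<open>a\<close> and \<open>m\<close>, times that of \<open>\<rho>\<close> between \<open>m\<close> and \<open>b\<close>, times a factor for
  \<open>m\<close> (\<open>word_weight_split_at_max\<close>). As the sets of letters of \<open>\<tau>\<close> and \<open>\<rho>\<close> are
  complementary and otherwise arbitrary, products of exponential generating functions appear
  (\<open>egf_coeff_mult\<close>), and removing \<open>m\<close> is differentiation.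

  Write \<open>q = u1 u2\<close>. Let \<open>P\<close> be the generating function of the nonempty words between two large
  boundary letters, and \<open>L\<close>, \<open>R\<close> those of all words between 0 and a large letter, and
  between a large letter and 0. Distinguishing whether \<open>\<tau>\<close> and \<open>\<rho>\<close> are empty one finds

    \<open>P' = q + (u3 + u4) P + P\<^sup>2\<close>,
    \<open>L' = L (\<alpha> u3 t + \<alpha> f P)\<close>,
    \<open>R' = R (\<beta> u4 t + \<beta> g P)\<close>.

  In a permutation of \<open>{1..n+1}\<close> the letter \<open>n+1\<close> contributes the factor 1, which is what the
  exponents lowered by 1 express, so the generating function sought is \<open>L R\<close>.

  Let \<open>Q = 1 / D\<close> be the quotient in the theorem. For \<open>x \<noteq> y\<close> the series \<open>D\<close> is a
  combination of \<open>exp (x z)\<close> and \<open>exp (y z)\<close>, whence \<open>D'' = (x + y) D' - x y D\<close>, which persists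
  for \<open>x = y\<close>. Since \<open>x + y = u3 + u4\<close> and \<open>x y = q\<close>, this is precisely the Riccati equation
  of \<open>P\<close> for \<open>Q' / Q = - D' / D\<close> (\<open>exp_quotient_log_deriv\<close>). The other two equations
  are then solved by \<open>exp (\<alpha> u3 t z) Q\<^sup>\<alpha>\<^sup>f\<close> and \<open>exp (\<beta> u4 t z) Q\<^sup>\<beta>\<^sup>g\<close>.
\<close>

section \<open>Exponential generating functions and subsets\<close>

definition egf_coeff :: "'a::field_char_0 fps \<Rightarrow> nat \<Rightarrow> 'a" where
  "egf_coeff F n = fact n * fps_nth F n"

lemma egf_coeff_add: "egf_coeff (F + G) n = egf_coeff F n + egf_coeff G n"
  by (simp add: egf_coeff_def algebra_simps)

lemma egf_coeff_const_mult: "egf_coeff (fps_const c * F) n = c * egf_coeff F n"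
  by (simp add: egf_coeff_def)

lemma egf_coeff_one: "egf_coeff 1 n = (if n = 0 then 1 else 0)"
  by (simp add: egf_coeff_def)

lemma egf_coeff_Suc: "egf_coeff F (Suc n) = egf_coeff (fps_deriv F) n"
  by (simp add: egf_coeff_def algebra_simps)

text \<open>
  This form of the binomial convolution has the subsets themselves as summands, so that the counting
  below never has to relabel the letters of a word by an initial segment of the natural numbers.
\<close>
lemma egf_coeff_mult:
  assumes "finite A"
  shows "(\<Sum>B\<in>Pow A. egf_coeff F (card B) * egf_coeff G (card (A - B)))
       = egf_coeff (F * G) (card A)"
proof -
  let ?n = "card A"
  have "(\<Sum>B\<in>Pow A. egf_coeff F (card B) * egf_coeff G (card (A - B)))
      = (\<Sum>k\<in>{..?n}. \<Sum>B\<in>{B \<in> Pow A. card B = k}.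
            egf_coeff F (card B) * egf_coeff G (card (A - B)))"
    using assms by (intro sum.group[symmetric]) (auto intro: card_mono)
  also have "\<dots> = (\<Sum>k\<in>{..?n}. of_nat (?n choose k) * (egf_coeff F k * egf_coeff G (?n - k)))"
  proof (rule sum.cong[OF refl])
    fix k
    have "(\<Sum>B\<in>{B \<in> Pow A. card B = k}. egf_coeff F (card B) * egf_coeff G (card (A - B)))
        = (\<Sum>B\<in>{B \<in> Pow A. card B = k}. egf_coeff F k * egf_coeff G (?n - k))"
      using assms by (intro sum.cong) (auto simp: card_Diff_subset finite_subset)
    then show "(\<Sum>B\<in>{B \<in> Pow A. card B = k}. egf_coeff F (card B) * egf_coeff G (card (A - B)))
        = of_nat (?n choose k) * (egf_coeff F k * egf_coeff G (?n - k))"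
      using n_subsets[OF assms, of k] by (simp add: Pow_def)
  qed
  also have "\<dots> = (\<Sum>k\<in>{..?n}. fact ?n * (fps_nth F k * fps_nth G (?n - k)))"
    by (intro sum.cong) (auto simp: egf_coeff_def binomial_fact)
  also have "\<dots> = egf_coeff (F * G) ?n"
    by (simp add: egf_coeff_def fps_mult_nth sum_distrib_left atLeast0AtMost)
  finally show ?thesis .
qed

section \<open>Splitting words at a letter\<close>

lemma sum_permutations_split_at:
  assumes "m \<notin> A"
  shows "(\<Sum>w\<in>permutations_of_set (insert m A). F w)
       = (\<Sum>B\<in>Pow A. \<Sum>\<tau>\<in>permutations_of_set B. \<Sum>\<rho>\<in>permutations_of_set (A - B). F (\<tau> @ m # \<rho>))"
proof (cases "finite A")
  case True
  have "(\<Sum>B\<in>Pow A. \<Sum>\<tau>\<in>permutations_of_set B. \<Sum>\<rho>\<in>permutations_of_set (A - B). F (\<tau> @ m # \<rho>))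
      = (\<Sum>(B, \<tau>, \<rho>)\<in>(SIGMA B:Pow A. permutations_of_set B \<times> permutations_of_set (A - B)).
           F (\<tau> @ m # \<rho>))"
    using True by (simp add: finite_subset sum.cartesian_product sum.Sigma)
  \<comment> \<open>\<open>m\<close> occurs exactly once, so it can be found again as the first place where the scan stops.\<close>
  also have "\<dots> = (\<Sum>w\<in>permutations_of_set (insert m A). F w)"
  proof (rule sum.reindex_bij_witness[where
        j = "\<lambda>(B, \<tau>, \<rho>). \<tau> @ m # \<rho>" and
        i = "\<lambda>w. (set (takeWhile (\<lambda>c. c \<noteq> m) w), takeWhile (\<lambda>c. c \<noteq> m) w,
                  tl (dropWhile (\<lambda>c. c \<noteq> m) w))"], goal_cases)
    case (1 s)
    then obtain B \<tau> \<rho> where s: "s = (B, \<tau>, \<rho>)" "B \<subseteq> A" "set \<tau> = B" by (auto simp: permutations_of_set_def)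
    with assms have "\<forall>c\<in>set \<tau>. c \<noteq> m" by auto
    with s show ?case by (auto simp: takeWhile_append dropWhile_append)
  next
    case (2 s)
    then show ?case using assms by (auto simp: permutations_of_set_def)
  next
    case (3 w)
    then have "m \<in> set w" by (auto simp: permutations_of_set_def)
    then obtain \<tau> \<rho> where "w = \<tau> @ m # \<rho>" "m \<notin> set \<tau>" by (auto dest: split_list_first)
    moreover from this have "\<forall>c\<in>set \<tau>. c \<noteq> m" by auto
    ultimately show ?case by (auto simp: takeWhile_append dropWhile_append)
  next
    case (4 w)
    then have "m \<in> set w" by (auto simp: permutations_of_set_def)
    then obtain \<tau> \<rho> where w: "w = \<tau> @ m # \<rho>" "m \<notin> set \<tau>" by (auto dest: split_list_first)
    moreover from this have "\<forall>c\<in>set \<tau>. c \<noteq> m" by auto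
    ultimately show ?case using 4 assms
      by (auto simp: takeWhile_append dropWhile_append permutations_of_set_def)
  next
    case (5 s)
    then show ?case by auto
  qed
  finally show ?thesis by simp
next
  case False
  then show ?thesis using assms
    by (auto simp: permutations_of_set_infinite)
qed

definition padded :: "nat \<Rightarrow> nat list \<Rightarrow> nat \<Rightarrow> nat \<Rightarrow> nat" where
  "padded a w b i = (a # w @ [b]) ! i"

text \<open>
  Records are maxima that also beat the boundary letter on the side they are seen from: the index 0
  is included here, and the index \<open>length w + 1\<close> in the mirror image.
\<close>
definition lr_record :: "nat \<Rightarrow> nat list \<Rightarrow> nat \<Rightarrow> nat \<Rightarrow> bool" where
  "lr_record a w b i \<longleftrightarrow> (\<forall>j<i. padded a w b j < padded a w b i)"

definition rl_record :: "nat \<Rightarrow> nat list \<Rightarrow> nat \<Rightarrow> nat \<Rightarrow> bool" where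
  "rl_record a w b i \<longleftrightarrow> (\<forall>j\<in>{i<..length w + 1}. padded a w b j < padded a w b i)"

lemma padded_0: "padded a w b 0 = a"
  and padded_end: "padded a w b (Suc (length w)) = b"
  by (simp_all add: padded_def)

lemma padded_in_set: "i \<in> {1..length w} \<Longrightarrow> padded a w b i \<in> set w"
  by (cases i) (auto simp: padded_def nth_append)

lemma padded_append_left:
  "i \<le> Suc (length \<tau>) \<Longrightarrow> padded a (\<tau> @ m # \<rho>) b i = padded a \<tau> m i"
  by (cases i) (auto simp: padded_def nth_append le_Suc_eq)

lemma padded_append_right:
  "padded a (\<tau> @ m # \<rho>) b (Suc (length \<tau>) + i) = padded m \<rho> b i"
  using nth_append_length_plus[of "a # \<tau>" "m # \<rho> @ [b]" i] by (simp add: padded_def)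

lemma lr_record_append_left:
  "i \<le> Suc (length \<tau>) \<Longrightarrow> lr_record a (\<tau> @ m # \<rho>) b i = lr_record a \<tau> m i"
  by (simp add: lr_record_def padded_append_left)

lemma rl_record_append_right:
  "rl_record a (\<tau> @ m # \<rho>) b (Suc (length \<tau>) + i) = rl_record m \<rho> b i"
proof -
  have "{Suc (length \<tau>) + i<..length (\<tau> @ m # \<rho>) + 1} = (+) (Suc (length \<tau>)) ` {i<..length \<rho> + 1}"
  proof (intro set_eqI iffI)
    fix x assume "x \<in> {Suc (length \<tau>) + i<..length (\<tau> @ m # \<rho>) + 1}"
    then show "x \<in> (+) (Suc (length \<tau>)) ` {i<..length \<rho> + 1}"
      by (intro image_eqI[of _ _ "x - Suc (length \<tau>)"]) auto
  qed auto
  then show ?thesis unfolding rl_record_def by (simp only: ball_simps padded_append_right)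
qed

lemma not_lr_record:
  assumes "\<forall>c\<in>set w. c < a" "i \<in> {1..length w}"
  shows "\<not> lr_record a w b i"
proof -
  have "\<not> padded a w b 0 < padded a w b i"
    using padded_in_set[OF assms(2), of a b] assms(1) by (auto simp: padded_0)
  moreover have "0 < i" using assms(2) by auto
  ultimately show ?thesis unfolding lr_record_def by blast
qed

lemma not_rl_record:
  assumes "\<forall>c\<in>set w. c < b" "i \<in> {1..length w}"
  shows "\<not> rl_record a w b i"
proof -
  have "\<not> padded a w b (Suc (length w)) < padded a w b i"
    using padded_in_set[OF assms(2), of a b] assms(1) by (auto simp: padded_end)
  moreover have "Suc (length w) \<in> {i<..length w + 1}" using assms(2) by auto
  ultimately show ?thesis unfolding rl_record_def by blast
qed

text \<open>
  The next two lemmas match the previous two: the largest letter hides what lies behind it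
  both in the whole word and when it serves as a boundary letter of a piece.
\<close>
lemma not_lr_record_append_right:
  assumes "\<forall>c\<in>set \<rho>. c < m" "i \<in> {1..length \<rho>}"
  shows "\<not> lr_record a (\<tau> @ m # \<rho>) b (Suc (length \<tau>) + i)"
proof -
  have "padded m \<rho> b i < m" using padded_in_set[OF assms(2)] assms(1) by blast
  then have "\<not> padded a (\<tau> @ m # \<rho>) b (Suc (length \<tau>) + 0)
      < padded a (\<tau> @ m # \<rho>) b (Suc (length \<tau>) + i)"
    by (simp only: padded_append_right padded_0)
  moreover have "Suc (length \<tau>) + 0 < Suc (length \<tau>) + i" using assms by auto
  ultimately show ?thesis unfolding lr_record_def by blast
qed

lemma not_rl_record_append_left:
  assumes "\<forall>c\<in>set \<tau>. c < m" "i \<in> {1..length \<tau>}"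
  shows "\<not> rl_record a (\<tau> @ m # \<rho>) b i"
proof -
  have "padded a \<tau> m i < m" using padded_in_set[OF assms(2)] assms(1) by blast
  then have "\<not> padded a (\<tau> @ m # \<rho>) b (Suc (length \<tau>)) < padded a (\<tau> @ m # \<rho>) b i"
    using assms(2) by (simp add: padded_append_left padded_end)
  moreover have "Suc (length \<tau>) \<in> {i<..length (\<tau> @ m # \<rho>) + 1}" using assms(2) by auto
  ultimately show ?thesis unfolding rl_record_def by blast
qed

lemma remove_Max:
  assumes "finite (A :: nat set)" "A \<noteq> {}"
  obtains m A' where "A = insert m A'" "m \<notin> A'" "finite A'" "\<forall>c\<in>A'. c < m"
proof
  have "Max A \<in> A" using assms by simp
  then show "A = insert (Max A) (A - {Max A})" by blast
  show "\<forall>c\<in>A - {Max A}. c < Max A" using assms by (auto simp: order_less_le)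
qed (use assms in auto)

section \<open>Weights of words between two boundary letters\<close>

context
  fixes q u3 u4 f g t \<alpha> \<beta> :: "'a :: field_char_0"
begin

text \<open>
  The four cases in the first factor are peak, double ascent, double descent and valley. A left
  record has a lower left neighbour, so \<open>lower_right\<close> decides whether it is a peak or a double
  ascent; right records are mirrored. A letter that is a record from both sides is the overall
  maximum. It gets no record factor, in accordance with the exponents
  \<open>lmaxpk - 1\<close>, \<open>rmaxpk - 1\<close>, \<open>lmax - 1\<close> and \<open>rmax - 1\<close>.
\<close>
definition letter_weight :: "bool \<Rightarrow> bool \<Rightarrow> bool \<Rightarrow> bool \<Rightarrow> 'a" where
  "letter_weight lower_left lower_right lr rl =
     (if lower_left then (if lower_right then 1 else u3) else (if lower_right then u4 else q))
     * (if lr \<and> \<not> rl then \<alpha> * (if lower_right then f else t)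
        else if rl \<and> \<not> lr then \<beta> * (if lower_left then g else t) else 1)"

definition word_weight :: "nat \<Rightarrow> nat list \<Rightarrow> nat \<Rightarrow> 'a" where
  "word_weight a w b = (\<Prod>i\<in>{1..length w}.
     letter_weight (padded a w b (i - 1) < padded a w b i) (padded a w b (i + 1) < padded a w b i)
       (lr_record a w b i) (rl_record a w b i))"

text \<open>
  Every letter of \<open>\<tau>\<close> keeps its neighbours and its left record status when \<open>m \<rho>\<close> is replaced by
  the boundary letter \<open>m\<close>, and it is not a right record before or after; the same holds for
  \<open>\<rho>\<close> with the sides exchanged. The neighbours of \<open>m\<close> are lower, except for a boundary
  letter that is adjacent to it and not lower.
\<close>
lemma word_weight_split_at_max:
  assumes \<tau>: "\<forall>c\<in>set \<tau>. c < m" and \<rho>: "\<forall>c\<in>set \<rho>. c < m"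
  shows "word_weight a (\<tau> @ m # \<rho>) b = word_weight a \<tau> m
      * letter_weight (\<tau> \<noteq> [] \<or> a < m) (\<rho> \<noteq> [] \<or> b < m) (a < m) (b < m)
      * word_weight m \<rho> b"
proof -
  let ?k = "length \<tau>" and ?w = "\<tau> @ m # \<rho>"
  define h where "h i =
     letter_weight (padded a ?w b (i - 1) < padded a ?w b i) (padded a ?w b (i + 1) < padded a ?w b i)
       (lr_record a ?w b i) (rl_record a ?w b i)" for i
  have "word_weight a ?w b = prod h {1..?k + (1 + length \<rho>)}"
    unfolding word_weight_def by (rule prod.cong) (simp_all only: h_def, simp)
  also have "\<dots> = prod h {1..?k} * prod h {?k + 1..?k + (1 + length \<rho>)}"
    by (rule prod.ub_add_nat) simp
  also have "prod h {?k + 1..?k + (1 + length \<rho>)} = h (?k + 1) * prod h {1 + Suc ?k..length \<rho> + Suc ?k}"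
    using prod.atLeast_Suc_atMost[of "?k + 1" "?k + (1 + length \<rho>)" h] by (simp add: add_ac)
  also have "prod h {1 + Suc ?k..length \<rho> + Suc ?k} = (\<Prod>i\<in>{1..length \<rho>}. h (i + Suc ?k))"
    by (rule prod.shift_bounds_cl_nat_ivl)
  also have "\<dots> = word_weight m \<rho> b"
    unfolding word_weight_def
  proof (rule prod.cong[OF refl])
    fix i assume i: "i \<in> {1..length \<rho>}"
    have eq: "i + Suc ?k = Suc ?k + i" "Suc ?k + i - 1 = Suc ?k + (i - 1)"
      "Suc ?k + i + 1 = Suc ?k + (i + 1)" using i by auto
    show "h (i + Suc ?k) = letter_weight (padded m \<rho> b (i - 1) < padded m \<rho> b i)
       (padded m \<rho> b (i + 1) < padded m \<rho> b i) (lr_record m \<rho> b i) (rl_record m \<rho> b i)"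
      unfolding h_def eq padded_append_right rl_record_append_right
      using not_lr_record[OF \<rho> i] not_lr_record_append_right[OF \<rho> i] by simp
  qed
  also have "prod h {1..?k} = word_weight a \<tau> m"
    unfolding word_weight_def
  proof (rule prod.cong[OF refl])
    fix i assume i: "i \<in> {1..?k}"
    then have le: "i - 1 \<le> Suc ?k" "i \<le> Suc ?k" "i + 1 \<le> Suc ?k" by auto
    show "h i = letter_weight (padded a \<tau> m (i - 1) < padded a \<tau> m i)
       (padded a \<tau> m (i + 1) < padded a \<tau> m i) (lr_record a \<tau> m i) (rl_record a \<tau> m i)"
      unfolding h_def padded_append_left[OF le(1)] padded_append_left[OF le(2)]
        padded_append_left[OF le(3)] lr_record_append_left[OF le(2)]
      using not_rl_record[OF \<tau> i] not_rl_record_append_left[OF \<tau> i] by simp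
  qed
  also have "h (?k + 1) = letter_weight (\<tau> \<noteq> [] \<or> a < m) (\<rho> \<noteq> [] \<or> b < m) (a < m) (b < m)"
  proof -
    have mid: "padded a ?w b (?k + 1) = m"
      using padded_append_left[of "?k + 1" \<tau> a m \<rho> b] by (simp add: padded_end)
    have "padded a \<tau> m j < m \<longleftrightarrow> j \<noteq> 0 \<or> a < m" if "j < ?k + 1" for j
      using padded_in_set[of j \<tau> a m] \<tau> that by (cases j) (auto simp: padded_0)
    then have left: "padded a ?w b j < m \<longleftrightarrow> j \<noteq> 0 \<or> a < m" if "j < ?k + 1" for j
      using that by (simp add: padded_append_left)
    have "padded m \<rho> b j < m \<longleftrightarrow> j \<noteq> length \<rho> + 1 \<or> b < m" if "j \<in> {0<..length \<rho> + 1}" for j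
      using padded_in_set[of j \<rho> m b] \<rho> that by (cases "j = length \<rho> + 1") (auto simp: padded_end)
    note right = this
    have lr: "lr_record a ?w b (?k + 1) \<longleftrightarrow> a < m"
      unfolding lr_record_def mid using left by (metis zero_less_Suc Suc_eq_plus1)
    have "rl_record a ?w b (Suc ?k + 0) \<longleftrightarrow> b < m"
      unfolding rl_record_append_right unfolding rl_record_def padded_0 using right by force
    then have rl: "rl_record a ?w b (?k + 1) \<longleftrightarrow> b < m" by simp
    have "padded a ?w b (?k + 1 + 1) < m \<longleftrightarrow> \<rho> \<noteq> [] \<or> b < m"
      using right[of 1] padded_append_right[of a \<tau> m \<rho> b 1] by simp
    then show ?thesis unfolding h_def mid lr rl using left[of ?k] by simp
  qed
  finally show ?thesis by (simp only: mult_ac)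
qed

definition total_weight :: "nat \<Rightarrow> nat \<Rightarrow> nat set \<Rightarrow> 'a" where
  "total_weight a b A = (\<Sum>w\<in>permutations_of_set A. word_weight a w b)"

lemma total_weight_empty: "total_weight a b {} = 1"
  by (simp add: total_weight_def word_weight_def)

lemma total_weight_insert_max:
  assumes m: "\<forall>c\<in>A. c < m"
  shows "total_weight a b (insert m A) = (\<Sum>B\<in>Pow A.
     letter_weight (B \<noteq> {} \<or> a < m) (A - B \<noteq> {} \<or> b < m) (a < m) (b < m)
     * (total_weight a m B * total_weight m b (A - B)))"
proof -
  from m have "m \<notin> A" by auto
  then have "total_weight a b (insert m A) = (\<Sum>B\<in>Pow A. \<Sum>\<tau>\<in>permutations_of_set B.
      \<Sum>\<rho>\<in>permutations_of_set (A - B). word_weight a (\<tau> @ m # \<rho>) b)"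
    unfolding total_weight_def by (rule sum_permutations_split_at)
  also have "\<dots> = (\<Sum>B\<in>Pow A. \<Sum>\<tau>\<in>permutations_of_set B. \<Sum>\<rho>\<in>permutations_of_set (A - B).
      letter_weight (B \<noteq> {} \<or> a < m) (A - B \<noteq> {} \<or> b < m) (a < m) (b < m)
      * (word_weight a \<tau> m * word_weight m \<rho> b))"
  proof (intro sum.cong refl)
    fix B \<tau> \<rho>
    assume "B \<in> Pow A" "\<tau> \<in> permutations_of_set B" "\<rho> \<in> permutations_of_set (A - B)"
    then have *: "B \<subseteq> A" "set \<tau> = B" "set \<rho> = A - B" by (auto simp: permutations_of_set_def)
    then have "\<tau> \<noteq> [] \<longleftrightarrow> B \<noteq> {}" "\<rho> \<noteq> [] \<longleftrightarrow> A - B \<noteq> {}"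
      using set_empty by metis+
    moreover have "\<forall>c\<in>set \<tau>. c < m" "\<forall>c\<in>set \<rho>. c < m" using * m by auto
    ultimately show "word_weight a (\<tau> @ m # \<rho>) b
      = letter_weight (B \<noteq> {} \<or> a < m) (A - B \<noteq> {} \<or> b < m) (a < m) (b < m)
      * (word_weight a \<tau> m * word_weight m \<rho> b)"
      by (simp only: word_weight_split_at_max mult_ac)
  qed
  finally show ?thesis
    unfolding total_weight_def sum_product by (simp only: sum_distrib_left)
qed

section \<open>The three differential equations\<close>

text \<open>
  Between two large boundary letters there are no records, and the largest letter has weight \<open>q\<close>,
  \<open>u4\<close>, \<open>u3\<close> or 1 as both, only the left, only the right, or none of the two pieces is
  empty. The four cases are the four terms of the Riccati equation; the summand 1 in \<open>1 + P\<close>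
  counts the empty word.
\<close>
lemma total_weight_between_large:
  assumes P0: "fps_nth P 0 = 0"
    and P': "fps_deriv P = fps_const q + fps_const (u3 + u4) * P + P * P"
    and "finite A" "\<forall>c\<in>A. c < a \<and> c < b"
  shows "total_weight a b A = egf_coeff (1 + P) (card A)"
  using assms(3,4)
proof (induction A arbitrary: a b rule: finite_psubset_induct)
  case (psubset A)
  show ?case
  proof (cases "A = {}")
    case True
    then show ?thesis by (simp add: total_weight_empty egf_coeff_def P0)
  next
    case False
    with psubset.hyps obtain m A'
      where A: "A = insert m A'" "m \<notin> A'" "finite A'" "\<forall>c\<in>A'. c < m"
      by (rule remove_Max)
    have IH: "total_weight c d B = egf_coeff (1 + P) (card B)"
      if "B \<subseteq> A'" "\<forall>e\<in>B. e < c \<and> e < d" for c d B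
      using that A by (intro psubset.IH) auto
    have "total_weight a b A = (\<Sum>B\<in>Pow A'. letter_weight (B \<noteq> {}) (A' - B \<noteq> {}) False False
       * (total_weight a m B * total_weight m b (A' - B)))"
      unfolding A(1) total_weight_insert_max[OF A(4)] using psubset.prems A(1) by auto
    also have "\<dots> = (\<Sum>B\<in>Pow A'. egf_coeff P (card B) * egf_coeff P (card (A' - B))
        + u4 * (egf_coeff 1 (card B) * egf_coeff P (card (A' - B)))
        + u3 * (egf_coeff P (card B) * egf_coeff 1 (card (A' - B)))
        + q * (egf_coeff 1 (card B) * egf_coeff 1 (card (A' - B))))"
    proof (rule sum.cong[OF refl])
      fix B assume "B \<in> Pow A'"
      then have B: "B \<subseteq> A'" by simp
      then have fin: "finite B" "finite (A' - B)" using A(3) by (auto intro: finite_subset)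
      \<comment> \<open>A name for the complement keeps the case \<open>A' - B = {}\<close> from being rewritten to \<open>A' \<subseteq> B\<close>.\<close>
      define C where "C = A' - B"
      have "total_weight a m B = egf_coeff (1 + P) (card B)"
        "total_weight m b (A' - B) = egf_coeff (1 + P) (card (A' - B))"
        using B A psubset.prems by (intro IH; auto)+
      moreover have "egf_coeff P 0 = 0" by (simp add: egf_coeff_def P0)
      ultimately show "letter_weight (B \<noteq> {}) (A' - B \<noteq> {}) False False
       * (total_weight a m B * total_weight m b (A' - B))
       = egf_coeff P (card B) * egf_coeff P (card (A' - B))
        + u4 * (egf_coeff 1 (card B) * egf_coeff P (card (A' - B)))
        + u3 * (egf_coeff P (card B) * egf_coeff 1 (card (A' - B)))
        + q * (egf_coeff 1 (card B) * egf_coeff 1 (card (A' - B)))"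
        using fin unfolding C_def[symmetric] by (cases "B = {}"; cases "C = {}")
          (simp_all add: letter_weight_def egf_coeff_add egf_coeff_one)
    qed
    also have "\<dots> = egf_coeff (P * P + fps_const u4 * (1 * P) + fps_const u3 * (P * 1)
        + fps_const q * (1 * 1)) (card A')"
      by (simp only: sum.distrib sum_distrib_left[symmetric] egf_coeff_mult[OF A(3)]
          egf_coeff_add egf_coeff_const_mult)
    also have "P * P + fps_const u4 * (1 * P) + fps_const u3 * (P * 1) + fps_const q * (1 * 1)
        = fps_deriv P"
      by (simp add: P' algebra_simps flip: fps_const_add)
    also have "egf_coeff (fps_deriv P) (card A') = egf_coeff (1 + P) (card A)"
      using A by (simp add: egf_coeff_add egf_coeff_one egf_coeff_Suc)
    finally show ?thesis .
  qed
qed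

text \<open>
  With 0 on the left, the largest letter is a left record whose left neighbour is lower. It is a
  double ascent of weight \<open>\<alpha> u3 t\<close> if \<open>\<rho>\<close> is empty, and a peak of weight \<open>\<alpha> f\<close> otherwise.
  The piece \<open>\<tau>\<close> again lies between 0 and a large letter, \<open>\<rho>\<close> between two large ones.
\<close>
lemma total_weight_left_zero:
  assumes P0: "fps_nth P 0 = 0"
    and P': "fps_deriv P = fps_const q + fps_const (u3 + u4) * P + P * P"
    and L0: "fps_nth L 0 = 1"
    and L': "fps_deriv L = L * (fps_const (\<alpha> * u3 * t) + fps_const (\<alpha> * f) * P)"
    and "finite A" "\<forall>c\<in>A. 0 < c \<and> c < b"
  shows "total_weight 0 b A = egf_coeff L (card A)"
  using assms(5,6)
proof (induction A arbitrary: b rule: finite_psubset_induct)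
  case (psubset A)
  show ?case
  proof (cases "A = {}")
    case True
    then show ?thesis by (simp add: total_weight_empty egf_coeff_def L0)
  next
    case False
    with psubset.hyps obtain m A'
      where A: "A = insert m A'" "m \<notin> A'" "finite A'" "\<forall>c\<in>A'. c < m"
      by (rule remove_Max)
    have IH: "total_weight 0 m B = egf_coeff L (card B)" if "B \<subseteq> A'" for B
      using that A psubset.prems by (intro psubset.IH) auto
    have "total_weight 0 b A = (\<Sum>B\<in>Pow A'. letter_weight True (A' - B \<noteq> {}) True False
       * (total_weight 0 m B * total_weight m b (A' - B)))"
      unfolding A(1) total_weight_insert_max[OF A(4)] using psubset.prems A(1) by auto
    also have "\<dots> = (\<Sum>B\<in>Pow A'.
        (\<alpha> * u3 * t) * (egf_coeff L (card B) * egf_coeff 1 (card (A' - B)))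
        + (\<alpha> * f) * (egf_coeff L (card B) * egf_coeff P (card (A' - B))))"
    proof (rule sum.cong[OF refl])
      fix B assume "B \<in> Pow A'"
      then have B: "B \<subseteq> A'" by simp
      then have fin: "finite (A' - B)" using A(3) by auto
      \<comment> \<open>A name for the complement keeps the case \<open>A' - B = {}\<close> from being rewritten to \<open>A' \<subseteq> B\<close>.\<close>
      define C where "C = A' - B"
      have "total_weight m b (A' - B) = egf_coeff (1 + P) (card (A' - B))"
        using B A psubset.prems fin by (intro total_weight_between_large[OF P0 P']) auto
      moreover have "egf_coeff P 0 = 0" by (simp add: egf_coeff_def P0)
      ultimately show "letter_weight True (A' - B \<noteq> {}) True False
       * (total_weight 0 m B * total_weight m b (A' - B))
       = (\<alpha> * u3 * t) * (egf_coeff L (card B) * egf_coeff 1 (card (A' - B)))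
        + (\<alpha> * f) * (egf_coeff L (card B) * egf_coeff P (card (A' - B)))"
        using fin IH[OF B] unfolding C_def[symmetric] by (cases "C = {}")
          (simp_all add: letter_weight_def egf_coeff_add egf_coeff_one)
    qed
    also have "\<dots> = egf_coeff (fps_const (\<alpha> * u3 * t) * (L * 1) + fps_const (\<alpha> * f) * (L * P)) (card A')"
      by (simp only: sum.distrib sum_distrib_left[symmetric] egf_coeff_mult[OF A(3)]
          egf_coeff_add egf_coeff_const_mult)
    also have "fps_const (\<alpha> * u3 * t) * (L * 1) + fps_const (\<alpha> * f) * (L * P) = fps_deriv L"
      by (simp add: L' algebra_simps)
    also have "egf_coeff (fps_deriv L) (card A') = egf_coeff L (card A)"
      using A by (simp add: egf_coeff_Suc)
    finally show ?thesis .
  qed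
qed

text \<open>The mirror image, with double descents in place of double ascents.\<close>
lemma total_weight_right_zero:
  assumes P0: "fps_nth P 0 = 0"
    and P': "fps_deriv P = fps_const q + fps_const (u3 + u4) * P + P * P"
    and R0: "fps_nth R 0 = 1"
    and R': "fps_deriv R = R * (fps_const (\<beta> * u4 * t) + fps_const (\<beta> * g) * P)"
    and "finite A" "\<forall>c\<in>A. 0 < c \<and> c < a"
  shows "total_weight a 0 A = egf_coeff R (card A)"
  using assms(5,6)
proof (induction A arbitrary: a rule: finite_psubset_induct)
  case (psubset A)
  show ?case
  proof (cases "A = {}")
    case True
    then show ?thesis by (simp add: total_weight_empty egf_coeff_def R0)
  next
    case False
    with psubset.hyps obtain m A'
      where A: "A = insert m A'" "m \<notin> A'" "finite A'" "\<forall>c\<in>A'. c < m"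
      by (rule remove_Max)
    have IH: "total_weight m 0 B = egf_coeff R (card B)" if "B \<subseteq> A'" for B
      using that A psubset.prems by (intro psubset.IH) auto
    have "total_weight a 0 A = (\<Sum>B\<in>Pow A'. letter_weight (B \<noteq> {}) True False True
       * (total_weight a m B * total_weight m 0 (A' - B)))"
      unfolding A(1) total_weight_insert_max[OF A(4)] using psubset.prems A(1) by auto
    also have "\<dots> = (\<Sum>B\<in>Pow A'.
        (\<beta> * u4 * t) * (egf_coeff 1 (card B) * egf_coeff R (card (A' - B)))
        + (\<beta> * g) * (egf_coeff P (card B) * egf_coeff R (card (A' - B))))"
    proof (rule sum.cong[OF refl])
      fix B assume "B \<in> Pow A'"
      then have B: "B \<subseteq> A'" by simp
      then have fin: "finite B" using A(3) by (auto intro: finite_subset)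
      have "total_weight a m B = egf_coeff (1 + P) (card B)"
        using B A psubset.prems fin by (intro total_weight_between_large[OF P0 P']) auto
      moreover have "egf_coeff P 0 = 0" by (simp add: egf_coeff_def P0)
      ultimately show "letter_weight (B \<noteq> {}) True False True
       * (total_weight a m B * total_weight m 0 (A' - B))
       = (\<beta> * u4 * t) * (egf_coeff 1 (card B) * egf_coeff R (card (A' - B)))
        + (\<beta> * g) * (egf_coeff P (card B) * egf_coeff R (card (A' - B)))"
        using fin IH[of "A' - B"] by (cases "B = {}")
          (simp_all add: letter_weight_def egf_coeff_add egf_coeff_one)
    qed
    also have "\<dots> = egf_coeff (fps_const (\<beta> * u4 * t) * (1 * R) + fps_const (\<beta> * g) * (P * R)) (card A')"
      by (simp only: sum.distrib sum_distrib_left[symmetric] egf_coeff_mult[OF A(3)]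
          egf_coeff_add egf_coeff_const_mult)
    also have "fps_const (\<beta> * u4 * t) * (1 * R) + fps_const (\<beta> * g) * (P * R) = fps_deriv R"
      by (simp add: R' algebra_simps)
    also have "egf_coeff (fps_deriv R) (card A') = egf_coeff R (card A)"
      using A by (simp add: egf_coeff_Suc)
    finally show ?thesis .
  qed
qed

lemma total_weight_zero_zero:
  assumes P0: "fps_nth P 0 = 0"
    and P': "fps_deriv P = fps_const q + fps_const (u3 + u4) * P + P * P"
    and L0: "fps_nth L 0 = 1"
    and L': "fps_deriv L = L * (fps_const (\<alpha> * u3 * t) + fps_const (\<alpha> * f) * P)"
    and R0: "fps_nth R 0 = 1"
    and R': "fps_deriv R = R * (fps_const (\<beta> * u4 * t) + fps_const (\<beta> * g) * P)"
  shows "total_weight 0 0 {1..n+1} = egf_coeff (L * R) n"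
proof -
  have "{1..n+1} = insert (n+1) {1..n}" by auto
  then have "total_weight 0 0 {1..n+1}
     = (\<Sum>B\<in>Pow {1..n}. total_weight 0 (n+1) B * total_weight (n+1) 0 ({1..n} - B))"
    by (simp add: total_weight_insert_max letter_weight_def)
  also have "\<dots> = (\<Sum>B\<in>Pow {1..n}. egf_coeff L (card B) * egf_coeff R (card ({1..n} - B)))"
  proof (rule sum.cong[OF refl])
    fix B assume B: "B \<in> Pow {1..n}"
    then have "finite B" by (auto intro: finite_subset)
    with B have "total_weight 0 (n+1) B = egf_coeff L (card B)"
      by (intro total_weight_left_zero[OF P0 P' L0 L']) auto
    moreover have "total_weight (n+1) 0 ({1..n} - B) = egf_coeff R (card ({1..n} - B))"
      using B by (intro total_weight_right_zero[OF P0 P' R0 R']) auto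
    ultimately show "total_weight 0 (n+1) B * total_weight (n+1) 0 ({1..n} - B)
       = egf_coeff L (card B) * egf_coeff R (card ({1..n} - B))" by simp
  qed
  also have "\<dots> = egf_coeff (L * R) n" by (simp add: egf_coeff_mult)
  finally show ?thesis .
qed

section \<open>The statistics as a product of letter weights\<close>

lemma power_card_filter:
  "finite I \<Longrightarrow> (c::'a) ^ card {i \<in> I. Q i} = (\<Prod>i\<in>I. if Q i then c else 1)"
  by (simp flip: prod.inter_filter)

text \<open>
  Neighbouring letters are distinct, so two comparisons per letter decide its type. Exactly one
  letter is a maximum from both sides, namely the peak given by \<open>largest_letter\<close>. Lowering an
  exponent by 1 therefore means omitting this position, and the remaining maxima are those that
  are seen from one side only.
\<close>
lemma word_weight_eq_statistics:
  assumes w: "w \<in> permutations_of_set {1..n+1}"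
  shows "q ^ val w * u3 ^ da w * u4 ^ dd w
        * f ^ (lmaxpk w - 1) * g ^ (rmaxpk w - 1) * t ^ (lmaxda w + rmaxdd w)
        * \<alpha> ^ (lmax w - 1) * \<beta> ^ (rmax w - 1) = word_weight 0 w 0"
proof -
  let ?I = "{1..length w}" and ?p = "padded 0 w 0"
  define up dn lr rl where
    "up i \<longleftrightarrow> ?p (i - 1) < ?p i" and "dn i \<longleftrightarrow> ?p (i + 1) < ?p i"
    and "lr i \<longleftrightarrow> lr_record 0 w 0 i" and "rl i \<longleftrightarrow> rl_record 0 w 0 i" for i
  have set_w: "set w = {1..n+1}" and dist: "distinct w"
    using w by (auto simp: permutations_of_set_def)
  have letter: "letter w = ?p" by (simp add: fun_eq_iff letter_def padded_def)
  have pos: "0 < ?p i" if "i \<in> ?I" for i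
    using padded_in_set[OF that, of 0 0] set_w by auto
  have neq: "?p i \<noteq> ?p (Suc i)" if "i \<le> length w" for i
  proof (cases "i = 0 \<or> i = length w")
    case True
    moreover have "w \<noteq> []" using set_w by auto
    ultimately show ?thesis
      using pos[of "Suc i"] pos[of i] that by (cases "i = 0") (auto simp: padded_0 padded_end Suc_le_eq)
  next
    case False
    then obtain k where "i = Suc k" by (cases i) auto
    then show ?thesis using that False dist
      by (auto simp: padded_def nth_append nth_eq_iff_index_eq)
  qed
  have up: "?p i < ?p (i - 1) \<longleftrightarrow> \<not> up i" if "i \<in> ?I" for i
    using neq[of "i - 1"] that by (cases i) (auto simp: up_def not_less le_less)
  have dn: "?p i < ?p (i + 1) \<longleftrightarrow> \<not> dn i" if "i \<in> ?I" for i
    using neq[of i] that by (auto simp: dn_def not_less le_less)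
  have lr_up: "up i" if "i \<in> ?I" "lr i" for i
    using that by (auto simp: lr_def up_def lr_record_def)
  have rl_dn: "dn i" if "i \<in> ?I" "rl i" for i
    using that by (auto simp: rl_def dn_def rl_record_def)
  have sets: "valleys w = {i \<in> ?I. \<not> up i \<and> \<not> dn i}" "double_ascents w = {i \<in> ?I. up i \<and> \<not> dn i}"
     "double_descents w = {i \<in> ?I. \<not> up i \<and> dn i}" "peaks w = {i \<in> ?I. up i \<and> dn i}"
    unfolding valleys_def double_ascents_def double_descents_def peaks_def letter
    by (rule Collect_cong, rule conj_cong[OF refl], simp only: up dn, simp only: up_def dn_def)+
      (simp only: up_def dn_def)
  have lr_set: "lr_maxima w = {i \<in> ?I. lr i}"
  proof -
    have "(\<forall>j. 1 \<le> j \<and> j < i \<longrightarrow> ?p i > ?p j) \<longleftrightarrow> lr i" if "i \<in> ?I" for i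
      using pos[OF that] unfolding lr_def lr_record_def
      by (metis One_nat_def Suc_leI padded_0 gr0I)
    then show ?thesis unfolding lr_maxima_def letter by auto
  qed
  have rl_set: "rl_maxima w = {i \<in> ?I. rl i}"
  proof -
    have "(\<forall>j. i < j \<and> j \<le> length w \<longrightarrow> ?p i > ?p j) \<longleftrightarrow> rl i" if "i \<in> ?I" for i
      using pos[OF that] unfolding rl_def rl_record_def
      by (auto simp: le_Suc_eq padded_end)
    then show ?thesis unfolding rl_maxima_def letter by auto
  qed
  obtain k where k: "k \<in> peaks w" "k \<in> lr_maxima w" "k \<in> rl_maxima w"
    using largest_letter[OF w] by blast
  have both: "lr i \<and> rl i \<longleftrightarrow> i = k" if i: "i \<in> ?I" for i
  proof
    assume i': "lr i \<and> rl i"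
    have k': "k \<in> ?I" "lr k" "rl k" using k lr_set rl_set by auto
    have later: "?p a < ?p b" "?p b < ?p a" if "a < b" "b \<in> ?I" "lr b" "rl a" for a b
      using that unfolding lr_def rl_def lr_record_def rl_record_def by auto
    have "\<not> i < k" "\<not> k < i"
      using later[of i k] later[of k i] i i' k' less_asym by blast+
    then show "i = k" by simp
  qed (use k lr_set rl_set in auto)
  have types: "\<forall>i\<in>?I. (lr i \<and> rl i \<longleftrightarrow> i = k) \<and> (lr i \<longrightarrow> up i) \<and> (rl i \<longrightarrow> dn i)"
    using both lr_up rl_dn by simp
  have minus: "card X - 1 = card (X - {k})" if "k \<in> X" for X
    using that by simp
  have diffs: "lr_maxima w - {k} = {i \<in> ?I. lr i \<and> \<not> rl i}"
    "rl_maxima w - {k} = {i \<in> ?I. rl i \<and> \<not> lr i}"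
    "lr_maxima w \<inter> peaks w - {k} = {i \<in> ?I. lr i \<and> \<not> rl i \<and> dn i}"
    "rl_maxima w \<inter> peaks w - {k} = {i \<in> ?I. rl i \<and> \<not> lr i \<and> up i}"
    "lr_maxima w \<inter> double_ascents w = {i \<in> ?I. lr i \<and> \<not> rl i \<and> \<not> dn i}"
    "rl_maxima w \<inter> double_descents w = {i \<in> ?I. rl i \<and> \<not> lr i \<and> \<not> up i}"
    using types unfolding lr_set rl_set sets by blast+
  have cards: "lmax w - 1 = card {i \<in> ?I. lr i \<and> \<not> rl i}"
    "rmax w - 1 = card {i \<in> ?I. rl i \<and> \<not> lr i}"
    "lmaxpk w - 1 = card {i \<in> ?I. lr i \<and> \<not> rl i \<and> dn i}"
    "rmaxpk w - 1 = card {i \<in> ?I. rl i \<and> \<not> lr i \<and> up i}"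
    using k unfolding lmax_def rmax_def lmaxpk_def rmaxpk_def
    by (subst minus; simp add: diffs)+
  show ?thesis
    unfolding cards val_def da_def dd_def lmaxda_def rmaxdd_def diffs
    unfolding sets power_add
    unfolding word_weight_def up_def[symmetric] dn_def[symmetric] lr_def[symmetric] rl_def[symmetric]
    unfolding power_card_filter[OF finite_atLeastAtMost] prod.distrib[symmetric]
    by (rule prod.cong) (auto simp: letter_weight_def)
qed

end

section \<open>Solving the differential equations\<close>

lemma fps_linear_ode_unique:
  fixes F G H :: "'a::field_char_0 fps"
  assumes "fps_deriv F = F * H" "fps_deriv G = G * H" "fps_nth F 0 = fps_nth G 0"
  shows "F = G"
proof (rule fps_ext)
  fix n
  show "fps_nth F n = fps_nth G n"
  proof (induction n rule: less_induct)
    case (less n)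
    show ?case
    proof (cases n)
      case 0
      then show ?thesis using assms(3) by simp
    next
      case (Suc m)
      have "fps_nth (F * H) m = fps_nth (G * H) m"
        unfolding fps_mult_nth using less.IH Suc by (intro sum.cong) auto
      then have "fps_nth (fps_deriv F) m = fps_nth (fps_deriv G) m" using assms by simp
      then show ?thesis unfolding Suc fps_deriv_nth
        by (metis add_is_0 mult_left_cancel of_nat_eq_0_iff one_neq_zero Suc_eq_plus1)
    qed
  qed
qed

lemma fps_cpower_nth_0: "fps_nth (fps_cpower S c) 0 = 1"
  by (simp add: fps_cpower_def)

text \<open>
  Together with uniqueness of the solution, this replaces the functional equation
  \<open>S\<^sup>c S\<^sup>d = S\<^sup>c\<^sup>+\<^sup>d\<close>.
\<close>
lemma fps_deriv_cpower:
  fixes S :: "'a::field_char_0 fps"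
  assumes "fps_nth S 0 = 1"
  shows "fps_deriv (fps_cpower S c) = fps_cpower S c * (fps_const c * (fps_deriv S * inverse S))"
proof -
  have S0: "fps_nth (S - 1) 0 = 0" using assms by simp
  have "(inverse (1 + fps_X) :: 'a fps) oo (S - 1) = inverse ((1 + fps_X) oo (S - 1))"
    by (rule fps_inverse_compose) (use S0 in auto)
  also have "(1 + fps_X) oo (S - 1) = S"
    using S0 by (simp add: fps_compose_add_distrib)
  finally have "fps_deriv (fps_ln 1 oo (S - 1)) = inverse S * fps_deriv S"
    using S0 by (simp add: fps_compose_deriv fps_ln_deriv)
  then show ?thesis
    by (simp add: fps_cpower_def fps_compose_deriv mult_ac)
qed

text \<open>
  For \<open>x \<noteq> y\<close> the equation is clear, as \<open>x\<close> and \<open>y\<close> are the roots of its characteristic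
  polynomial. The proof by coefficients covers \<open>x = y\<close> too; it amounts to the recurrence of the
  complete homogeneous symmetric polynomials in \<open>x\<close> and \<open>y\<close>.
\<close>
lemma reduced_denominator_ode:
  "fps_deriv (fps_deriv (reduced_denominator x y))
     = fps_const (x + y) * fps_deriv (reduced_denominator x y)
       - fps_const (x * y) * reduced_denominator x y"
proof -
  \<comment> \<open>The index is shifted: \<open>h n\<close> is the complete homogeneous polynomial of degree \<open>n - 1\<close>, and \<open>h 0 = 0\<close>.\<close>
  define h where "h n = (\<Sum>k<n. x ^ k * y ^ (n - 1 - k))" for n
  have h_0: "h 0 = 0" by (simp add: h_def)
  have h_Suc: "h (Suc n) = y * h n + x ^ n" for n
  proof -
    have "(\<Sum>k<n. x ^ k * y ^ (n - k)) = (\<Sum>k<n. y * (x ^ k * y ^ (n - 1 - k)))"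
      by (intro sum.cong) (auto simp: Suc_diff_Suc simp flip: power_Suc)
    then show ?thesis by (simp add: h_def sum_distrib_left)
  qed
  have D: "fact n * fps_nth (reduced_denominator x y) n = (if n = 0 then 1 else - (x * y * h (n - 1)))" for n
    by (simp add: reduced_denominator_def h_def numeral_2_eq_2)
  have "egf_coeff (reduced_denominator x y) (Suc (Suc n)) =
      (x + y) * egf_coeff (reduced_denominator x y) (Suc n) - x * y * egf_coeff (reduced_denominator x y) n" for n
    unfolding egf_coeff_def D by (cases n) (simp_all add: h_Suc h_0 algebra_simps)
  then have "egf_coeff (fps_deriv (fps_deriv (reduced_denominator x y))) n
    = egf_coeff (fps_const (x + y) * fps_deriv (reduced_denominator x y)
       - fps_const (x * y) * reduced_denominator x y) n" for n
    by (simp add: egf_coeff_Suc) (simp add: egf_coeff_def algebra_simps)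
  then show ?thesis by (intro fps_ext) (simp add: egf_coeff_def)
qed

text \<open>
  The usual linearisation of a Riccati equation: \<open>P = - D' / D\<close> solves it because the denominator
  \<open>D\<close> solves a linear equation of order two.
\<close>
lemma exp_quotient_log_deriv:
  fixes x y :: "'a::field_char_0"
  defines "P \<equiv> fps_deriv (exp_quotient x y) * inverse (exp_quotient x y)"
  shows "fps_nth P 0 = 0"
    and "fps_deriv P = fps_const (x * y) + fps_const (x + y) * P + P * P"
proof -
  define D where "D = reduced_denominator x y"
  have D0: "fps_nth D 0 = 1" by (simp add: D_def reduced_denominator_def)
  have Q: "exp_quotient x y = inverse D" by (simp add: exp_quotient_def D_def)
  have inv: "inverse (inverse D) = D" "D * inverse D = 1"
    using D0 by (simp_all add: fps_inverse_idempotent inverse_mult_eq_1')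
  have P: "P = - (fps_deriv D * inverse D)"
    unfolding P_def Q using D0 inv
    by (simp add: fps_inverse_deriv power2_eq_square mult_ac)
  have "fps_nth (fps_deriv D) 0 = 0" by (simp add: D_def reduced_denominator_def)
  then show "fps_nth P 0 = 0" by (simp add: P)
  have "fps_deriv P = - (fps_deriv (fps_deriv D) * inverse D) + P * P"
    unfolding P using D0 by (simp add: fps_inverse_deriv power2_eq_square algebra_simps)
  also have "fps_deriv (fps_deriv D) * inverse D
      = fps_const (x + y) * (fps_deriv D * inverse D) - fps_const (x * y) * (D * inverse D)"
    unfolding D_def reduced_denominator_ode by (simp add: algebra_simps)
  finally show "fps_deriv P = fps_const (x * y) + fps_const (x + y) * P + P * P"
    by (simp add: inv P)
qed

theorem theorem1p3:
  fixes x y u1 u2 u3 u4 f g t \<alpha> \<beta> :: "'a :: field_char_0"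
  assumes "x * y = u1 * u2"
    and "x + y = u3 + u4"
  shows "Abs_fps (\<lambda>n. A_poly n u1 u2 u3 u4 f g t \<alpha> \<beta> / fact n)
       = fps_exp ((\<alpha> * u3 + \<beta> * u4) * t) * fps_cpower (exp_quotient x y) (\<alpha> * f + \<beta> * g)"
proof -
  define P where "P = fps_deriv (exp_quotient x y) * inverse (exp_quotient x y)"
  define E where "E r c = fps_exp r * fps_cpower (exp_quotient x y) c" for r c
  have P0: "fps_nth P 0 = 0"
    and P': "fps_deriv P = fps_const (u1 * u2) + fps_const (u3 + u4) * P + P * P"
    using exp_quotient_log_deriv[of x y] assms by (simp_all add: P_def)
  have E0: "fps_nth (E r c) 0 = 1" for r c
    by (simp add: E_def fps_cpower_nth_0)
  have E': "fps_deriv (E r c) = E r c * (fps_const r + fps_const c * P)" for r c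
    by (simp add: E_def P_def fps_deriv_cpower exp_quotient_nth_0 algebra_simps)
  have A: "A_poly n u1 u2 u3 u4 f g t \<alpha> \<beta>
      = egf_coeff (E (\<alpha> * u3 * t) (\<alpha> * f) * E (\<beta> * u4 * t) (\<beta> * g)) n" for n
    unfolding A_poly_def total_weight_zero_zero[OF P0 P' E0 E' E0 E', symmetric] total_weight_def
    by (intro sum.cong refl word_weight_eq_statistics)
  have "Abs_fps (\<lambda>n. A_poly n u1 u2 u3 u4 f g t \<alpha> \<beta> / fact n)
      = E (\<alpha> * u3 * t) (\<alpha> * f) * E (\<beta> * u4 * t) (\<beta> * g)"
    by (rule fps_ext) (simp add: A egf_coeff_def)
  also have "\<dots> = E ((\<alpha> * u3 + \<beta> * u4) * t) (\<alpha> * f + \<beta> * g)"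
  proof (rule fps_linear_ode_unique)
    show "fps_deriv (E (\<alpha> * u3 * t) (\<alpha> * f) * E (\<beta> * u4 * t) (\<beta> * g))
      = E (\<alpha> * u3 * t) (\<alpha> * f) * E (\<beta> * u4 * t) (\<beta> * g)
        * (fps_const ((\<alpha> * u3 + \<beta> * u4) * t) + fps_const (\<alpha> * f + \<beta> * g) * P)"
      by (simp add: E' algebra_simps flip: fps_const_add)
  qed (simp_all add: E0 E')
  finally show ?thesis by (simp add: E_def)
qed

end
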